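(* Let $k$ be a positive integer and let $\mathcal{S} = (V,f)$ be a bi-coloured system with $|V| = n$ in which any two distinct red lines intersect in at most $k$ points. Then $$m_{\mathcal{S}} \geq \frac{\binom{n}{2}}{\binom{k+2}{2}}.$$
   Context: For a set $V$, $\binom{V}{k}$ denotes the family of $k$-element subsets of $V$. A bi-coloured system is a pair $\mathcal{S} = (V,f)$ where $V$ is a finite set of points and $f : \binom{V}{3} \to \{R,B\}$ is any function. For $\{u,v\} \in \binom{V}{2}$, the red line and blue line generated by $u,v$ are $$R_{\mathcal{S}}(uv) = \{u,v\} \cup \{p : f(\{u,v,p\}) = R\}, \qquad B_{\mathcal{S}}(uv) = \{u,v\} \cup \{p : f(\{u,v,p\}) = B\}.$$ Two red lines are distinct if they are distinct as sets. Let $m_{\mathcal{S}}(R)$ and $m_{\mathcal{S}}(B)$ be the numbers of distinct red lines and distinct blue lines respectively, and $m_{\mathcal{S}} = m_{\mathcal{S}}(R) + m_{\mathcal{S}}(B)$ (red and blue lines are counted separately, even if a red line and a blue line are equal as sets). *)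

theory Defs
  imports Complex_Main
begin

datatype colour = Red | Blue

text \<open>
  A bi-coloured system is a finite set \<open>V\<close> of points with a function \<open>f\<close> colouring its
  3-element subsets. Here \<open>f\<close> is total on \<open>'a set\<close>; a line with \<open>u\<close>, \<open>v\<close> distinct points of
  \<open>V\<close> only depends on the values of \<open>f\<close> on 3-element subsets of \<open>V\<close>, because \<open>p\<close> is taken
  from \<open>V - {u, v}\<close>.
\<close>

definition coloured_line :: "'a set \<Rightarrow> ('a set \<Rightarrow> colour) \<Rightarrow> colour \<Rightarrow> 'a \<Rightarrow> 'a \<Rightarrow> 'a set" where
  "coloured_line V f c u v = {u, v} \<union> {p \<in> V - {u, v}. f {u, v, p} = c}"

definition coloured_lines :: "'a set \<Rightarrow> ('a set \<Rightarrow> colour) \<Rightarrow> colour \<Rightarrow> 'a set set" where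
  "coloured_lines V f c = {coloured_line V f c u v | u v. u \<in> V \<and> v \<in> V \<and> u \<noteq> v}"

definition num_coloured_lines :: "'a set \<Rightarrow> ('a set \<Rightarrow> colour) \<Rightarrow> colour \<Rightarrow> nat" where
  "num_coloured_lines V f c = card (coloured_lines V f c)"

definition num_lines :: "'a set \<Rightarrow> ('a set \<Rightarrow> colour) \<Rightarrow> nat" where
  "num_lines V f = num_coloured_lines V f Red + num_coloured_lines V f Blue"

end

theory Submission
  imports Defs
begin

text \<open>
  If the pair \<open>e\<close> generates the red line \<open>L\<close>, then its blue line is \<open>e \<union> (V - L)\<close>. So two pairs with
  the same blue line and red lines \<open>L\<close>, \<open>L'\<close> satisfy \<open>L - e = L' - e'\<close>, a subset of \<open>L \<inter> L'\<close>. Hence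
  the pairs whose red line has more than \<open>k + 2\<close> points generate pairwise distinct blue lines, while
  any other red line contains at most \<open>(k + 2) choose 2\<close> pairs.
\<close>

text \<open>Taking the generating pair as a set makes the lines of one colour the image of the
  2-subsets of \<open>V\<close>, so counting lines becomes a matter of images and
  injectivity.\<close>

definition pair_line :: "'a set \<Rightarrow> ('a set \<Rightarrow> colour) \<Rightarrow> colour \<Rightarrow> 'a set \<Rightarrow> 'a set" where
  "pair_line V f c e = e \<union> {p \<in> V - e. f (insert p e) = c}"

lemma coloured_line_eq_pair_line: "coloured_line V f c u v = pair_line V f c {u, v}"
  by (simp add: coloured_line_def pair_line_def insert_commute)

lemma coloured_lines_eq_image:
  "coloured_lines V f c = pair_line V f c ` {e. e \<subseteq> V \<and> card e = 2}"
proof -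
  have "{e. e \<subseteq> V \<and> card e = 2} = {{u, v} | u v. u \<in> V \<and> v \<in> V \<and> u \<noteq> v}"
    by (auto simp: card_2_iff)
  then show ?thesis
    unfolding coloured_lines_def coloured_line_eq_pair_line by auto
qed

lemma subset_pair_line: "e \<subseteq> pair_line V f c e"
  by (auto simp: pair_line_def)

lemma pair_line_subset: "e \<subseteq> V \<Longrightarrow> pair_line V f c e \<subseteq> V"
  by (auto simp: pair_line_def)

text \<open>With only two colours, a point of \<open>V\<close> outside \<open>e\<close> lies on
  exactly one of the two lines of \<open>e\<close>, while the points of \<open>e\<close> lie on
  both.\<close>

lemma red_minus_pair_eq_compl_blue:
  "e \<subseteq> V \<Longrightarrow> pair_line V f Red e - e = V - pair_line V f Blue e"
  using colour.exhaust by (auto simp: pair_line_def)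

text \<open>The common set \<open>L - e = L' - e'\<close> has more than \<open>k\<close> points,
  which is too many for two distinct red lines. So \<open>L = L'\<close>, and removing the common
  set from this line leaves both \<open>e\<close> and \<open>e'\<close>.\<close>

lemma same_blue_line_imp_eq:
  assumes "finite V" and "e \<subseteq> V" "card e = 2" "e' \<subseteq> V"
    and big: "card (pair_line V f Red e) > k + 2"
    and meet: "pair_line V f Red e \<noteq> pair_line V f Red e' \<Longrightarrow>
      card (pair_line V f Red e \<inter> pair_line V f Red e') \<le> k"
    and blue: "pair_line V f Blue e = pair_line V f Blue e'"
  shows "e = e'"
proof -
  let ?L = "pair_line V f Red e" and ?L' = "pair_line V f Red e'"
  have eq: "?L - e = ?L' - e'"
    using assms by (simp add: red_minus_pair_eq_compl_blue)
  have fin: "finite ?L" "finite e"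
    using finite_subset[OF _ \<open>finite V\<close>] pair_line_subset[OF \<open>e \<subseteq> V\<close>] \<open>e \<subseteq> V\<close> by simp_all
  have "card (?L - e) = card ?L - 2"
    using fin assms(3) by (simp add: card_Diff_subset subset_pair_line)
  moreover have "card (?L - e) \<le> card (?L \<inter> ?L')"
    using eq fin by (intro card_mono) blast+
  ultimately have "?L = ?L'"
    using big meet by linarith
  with eq show ?thesis
    using subset_pair_line[of e V f Red] subset_pair_line[of e' V f Red] by blast
qed

theorem theorem3:
  fixes k n :: nat and V :: "'a set" and f :: "'a set \<Rightarrow> colour"
  assumes "k \<ge> 1"
    and "finite V"
    and "card V = n"
    and "\<And>L L'. L \<in> coloured_lines V f Red \<Longrightarrow> L' \<in> coloured_lines V f Red \<Longrightarrow> L \<noteq> L'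
           \<Longrightarrow> card (L \<inter> L') \<le> k"
  shows "real (num_lines V f) \<ge> real (n choose 2) / real ((k + 2) choose 2)"
proof -
  define E where "E = {e. e \<subseteq> V \<and> card e = 2}"
  \<comment> \<open>The pairs in \<open>S\<close> will be charged to red lines, those in
    \<open>E - S\<close> to blue lines.\<close>
  define S where "S = {e \<in> E. card (pair_line V f Red e) \<le> k + 2}"
  let ?R = "pair_line V f Red" and ?B = "pair_line V f Blue" and ?K = "(k + 2) choose 2"
  have lines: "coloured_lines V f c = pair_line V f c ` E" for c
    unfolding E_def by (rule coloured_lines_eq_image)
  have finE: "finite E"
    using \<open>finite V\<close> by (simp add: E_def)
  have finS: "finite S" and SE: "S \<subseteq> E"
    using finE by (auto simp: S_def)
  have cardE: "card E = n choose 2"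
    using n_subsets[OF \<open>finite V\<close>] \<open>card V = n\<close> by (simp add: E_def)
  have Kpos: "?K \<ge> 1"
    using zero_less_binomial[of 2 "k + 2"] by (simp add: Suc_le_eq)

  have finL: "finite L" and pairsL: "card {e. e \<subseteq> L \<and> card e = 2} \<le> ?K" if "L \<in> ?R ` S" for L
  proof -
    from that obtain e where "e \<subseteq> V" "L = ?R e" "card L \<le> k + 2"
      unfolding S_def E_def by blast
    then show "finite L"
      using \<open>finite V\<close> pair_line_subset finite_subset by metis
    then show "card {e. e \<subseteq> L \<and> card e = 2} \<le> ?K"
      using binomial_right_mono[OF \<open>card L \<le> k + 2\<close>] by (simp only: n_subsets)
  qed
  \<comment> \<open>Each pair of \<open>S\<close> lies inside its own red line, so the pairs inside
    these short lines cover \<open>S\<close>; a union bound over the distinct lines follows.\<close>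
  have "card S \<le> card (\<Union>L \<in> ?R ` S. {e. e \<subseteq> L \<and> card e = 2})"
  proof (rule card_mono)
    show "finite (\<Union>L \<in> ?R ` S. {e. e \<subseteq> L \<and> card e = 2})"
      using finS finL by simp
    show "S \<subseteq> (\<Union>L \<in> ?R ` S. {e. e \<subseteq> L \<and> card e = 2})"
    proof
      fix e assume "e \<in> S"
      then have "card e = 2" by (simp add: S_def E_def)
      with \<open>e \<in> S\<close> show "e \<in> (\<Union>L \<in> ?R ` S. {e. e \<subseteq> L \<and> card e = 2})"
        using subset_pair_line[of e V f Red] by blast
    qed
  qed
  also have "\<dots> \<le> (\<Sum>L \<in> ?R ` S. card {e. e \<subseteq> L \<and> card e = 2})"
    by (rule card_UN_le) (simp add: finS)
  also have "\<dots> \<le> card (?R ` S) * ?K"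
    using pairsL sum_bounded_above[of "?R ` S" "\<lambda>L. card {e. e \<subseteq> L \<and> card e = 2}" ?K]
    by (simp only: of_nat_id)
  also have "\<dots> \<le> num_coloured_lines V f Red * ?K"
    unfolding num_coloured_lines_def lines
    using finE SE by (intro mult_right_mono card_mono) auto
  finally have small: "card S \<le> num_coloured_lines V f Red * ?K" .

  \<comment> \<open>The bound on intersections of red lines enters here.\<close>
  have "inj_on ?B (E - S)"
  proof (rule inj_onI)
    fix e e' assume e: "e \<in> E - S" "e' \<in> E - S" and "?B e = ?B e'"
    moreover have "card (?R e \<inter> ?R e') \<le> k" if "?R e \<noteq> ?R e'"
      using e that by (intro assms(4)) (simp_all add: lines)
    moreover have "e \<subseteq> V" "card e = 2" "e' \<subseteq> V" "card (?R e) > k + 2"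
      using e by (auto simp: E_def S_def)
    ultimately show "e = e'"
      using \<open>finite V\<close> same_blue_line_imp_eq[of V e e' k f] by blast
  qed
  then have "card (E - S) = card (?B ` (E - S))"
    by (simp add: card_image)
  also have "\<dots> \<le> num_coloured_lines V f Blue"
    unfolding num_coloured_lines_def lines using finE by (intro card_mono) auto
  \<comment> \<open>One blue line per pair is already enough; the factor \<open>?K\<close> is given
    away so that this bound adds up with the one for \<open>S\<close>.\<close>
  also have "\<dots> \<le> num_coloured_lines V f Blue * ?K"
    using Kpos by simp
  finally have large: "card (E - S) \<le> num_coloured_lines V f Blue * ?K" .

  have "card E = card S + card (E - S)"
    using finE finS SE by (simp add: card_Diff_subset card_mono)
  then have "n choose 2 \<le> num_lines V f * ?K"
    using small large cardE by (simp add: num_lines_def add_mult_distrib)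
  then have "real (n choose 2) \<le> real (num_lines V f) * real ?K"
    by (metis of_nat_le_iff of_nat_mult)
  then show ?thesis
    using Kpos by (simp add: divide_le_eq)
qed

end
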